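(* Let $N\ge1$ be an integer, $r,s>1$ and $0<\lambda<N$ with $\frac1r+\frac1s+\frac\lambda N>2$. Let $$K:=\sup\left\{\sum_{\substack{i,j\in\mathbb{Z}^N\\ i\ne j}}\frac{f(i)g(j)}{|i-j|^{\lambda}} : f\in\ell^r(\mathbb{Z}^N),\ g\in\ell^s(\mathbb{Z}^N),\ \|f\|_r=\|g\|_s=1\right\}.$$ Then there is a pair of positive functions $f,g:\mathbb{Z}^N\to(0,\infty)$ solving the Euler–Lagrange system $$\begin{cases}K\,(f(i))^{r-1}=\displaystyle\sum_{j\ne i}\frac{g(j)}{|i-j|^{\lambda}},\\[2mm] K\,(g(i))^{s-1}=\displaystyle\sum_{j\ne i}\frac{f(j)}{|i-j|^{\lambda}},\end{cases}\qquad i\in\mathbb{Z}^N.$$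
   Context: $|\cdot|$ is the Euclidean norm on $\mathbb{Z}^N\subset\mathbb{R}^N$, functions are real-valued, and $\|f\|_r=\left(\sum_{i\in\mathbb{Z}^N}|f(i)|^r\right)^{1/r}$. The constant $K$ is finite by the (known) discrete Hardy–Littlewood–Sobolev inequality; by duality it equals $\sup_{\|f\|_r=1}\left\|\sum_{j\ne\cdot}\frac{f(j)}{|\cdot-j|^\lambda}\right\|_t$ with $\frac1t+\frac1s=1$. *)

theory Defs
  imports "HOL-Analysis.Analysis"
begin

text \<open>
  The lattice of integer points in N-dimensional space is the type \<open>int ^ 'n\<close>,
  with \<open>CARD('n)\<close> in the role of N.
\<close>

definition lattice_norm :: "int ^ 'n::finite \<Rightarrow> real" where
  "lattice_norm x = norm (\<chi> k. real_of_int (x $ k))"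

definition lp_space :: "real \<Rightarrow> ('a \<Rightarrow> real) set" where
  "lp_space r = {f. (\<lambda>i. \<bar>f i\<bar> powr r) summable_on UNIV}"

text \<open>\<open>infsum\<close> is 0 on divergent sums, so this is meaningful only on \<open>lp_space r\<close>.\<close>
definition lp_norm :: "real \<Rightarrow> ('a \<Rightarrow> real) \<Rightarrow> real" where
  "lp_norm r f = (\<Sum>\<^sub>\<infinity>i. \<bar>f i\<bar> powr r) powr (1 / r)"

definition hls_form :: "real \<Rightarrow> (int ^ 'n::finite \<Rightarrow> real) \<Rightarrow> (int ^ 'n \<Rightarrow> real) \<Rightarrow> real" where
  "hls_form l f g =
     (\<Sum>\<^sub>\<infinity>(i, j) \<in> {(i, j). i \<noteq> j}. f i * g j / lattice_norm (i - j) powr l)"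

text \<open>
  The supremum is taken in the reals; under the hypotheses of the discrete
  Hardy-Littlewood-Sobolev inequality the double sums converge absolutely and the
  set is bounded above. The \<open>itself\<close> argument carries the dimension.
\<close>
definition hls_const :: "'n::finite itself \<Rightarrow> real \<Rightarrow> real \<Rightarrow> real \<Rightarrow> real" where
  "hls_const _ l r s =
     Sup {hls_form l f g | (f :: int ^ 'n \<Rightarrow> real) g.
            f \<in> lp_space r \<and> g \<in> lp_space s \<and> lp_norm r f = 1 \<and> lp_norm s g = 1}"

end

theory Submission
  imports Defs "HOL-Complex_Analysis.Great_Picard"
begin

text \<open>
  With \<open>k x = |x|^(-l)\<close> for nonzero \<open>x\<close> and \<open>k 0 = 0\<close>, the constant \<open>K\<close> is the norm of the
  bilinear form \<open>\<Sum>i j. f i * g j * k (i - j)\<close> on \<open>lp_space r \<times> lp_space s\<close>, and the system is the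
  Euler-Lagrange system of the problem of attaining this norm. The difficulty is that the
  problem is invariant under translations, so that a maximizing sequence may escape to infinity
  or spread out. Two facts deal with this.

  The first is a consequence of the strict inequality between the exponents. Since
  \<open>1/r + 1/s + l/N > 2\<close> leaves some room, a small power of \<open>f\<close> can be taken out of the form before
  the three-factor inequality of Young is applied (\<open>weighted_term_bound\<close>). So for normalized
  \<open>f\<close> and \<open>g\<close> the form is at most a constant times a positive power of \<open>sup \<bar>f\<bar>\<close>
  (\<open>normalized_bound\<close>). Hence \<open>K\<close> is finite, and near-maximizers have a value bounded
  away from 0, which a translation moves to the origin (\<open>concentrated_near_maximizer\<close>). A
  subsequence then converges pointwise to a pair \<open>f\<close>, \<open>g\<close> with \<open>f 0 > 0\<close>.

  The second is that the first-order condition survives pointwise limits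
  (\<open>euler_lagrange_limit\<close>). For a maximizing sequence \<open>F n\<close>, \<open>G n\<close> change the value of \<open>F n\<close> at
  a single point \<open>i\<close> by \<open>t\<close>. The inequality that defines \<open>K\<close> compares the new pair with the old
  one, and it involves \<open>F n\<close> and \<open>G n\<close> only through the value of the form, \<open>F n i\<close>, and the sum
  \<open>\<Sum>j. G n j * k (i - j)\<close>. All three converge, the last because \<open>k\<close> lies in the dual space of
  \<open>lp_space s\<close> (\<open>infsum_tendsto_conjugate\<close>). In the limit a function of \<open>t\<close> has a minimum at 0,
  and the vanishing of its derivative is the equation at \<open>i\<close>, with the constant \<open>K\<close> itself.

  Positivity propagates from \<open>f 0 > 0\<close> through the two equations, because \<open>k\<close> is positive away
  from 0. The argument works for every even kernel on a countably infinite abelian group that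
  satisfies the same summability (\<open>positive_solution\<close>); the lattice enters only through the
  convergence of \<open>\<Sum>x. |x|^(-p)\<close> for \<open>p > N\<close>.
\<close>

section \<open>Inverse powers of the lattice norm\<close>

lemma int_powr_summable:
  assumes "p > 1"
  shows "(\<lambda>m::int. (1 + \<bar>real_of_int m\<bar>) powr (- p)) summable_on UNIV"
proof -
  let ?a = "\<lambda>m::int. (1 + \<bar>real_of_int m\<bar>) powr (- p)"
  have "summable (\<lambda>n. real n powr (- p))"
    using assms by (simp add: summable_real_powr_iff)
  then have "summable (\<lambda>n. real (Suc n) powr (- p))"
    by (subst summable_Suc_iff)
  then have nat: "(\<lambda>n. (1 + real n) powr (- p)) summable_on UNIV"
    by (intro summable_nonneg_imp_summable_on) (simp_all add: add.commute)
  have "?a summable_on range int" "?a summable_on range (\<lambda>n. - int n)"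
    by (subst summable_on_reindex; use nat in \<open>simp add: inj_on_def o_def\<close>)+
  then have "?a summable_on range int \<union> range (\<lambda>n. - int n)"
    by (rule summable_on_union)
  moreover have "range int \<union> range (\<lambda>n. - int n) = UNIV"
    by (auto simp: image_iff) (metis int_cases2)
  ultimately show ?thesis
    by simp
qed

text \<open>
  The sum over vectors of a product over the components is the product of the
  one-dimensional sums; on finite sets of vectors it suffices to enlarge the set to a box.
\<close>
lemma summable_on_vec_prod:
  fixes a :: "'b \<Rightarrow> real"
  assumes "a summable_on UNIV" and nonneg: "\<And>m. 0 \<le> a m"
  shows "(\<lambda>x::'b ^ 'n::finite. \<Prod>k\<in>UNIV. a (x $ k)) summable_on UNIV"
proof (rule nonneg_bdd_above_summable_on)
  show "0 \<le> (\<Prod>k\<in>UNIV. a (x $ k))" for x :: "'b ^ 'n"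
    by (intro prod_nonneg nonneg)
  show "bdd_above (sum (\<lambda>x::'b ^ 'n. \<Prod>k\<in>UNIV. a (x $ k)) ` {F. F \<subseteq> UNIV \<and> finite F})"
  proof (rule bdd_aboveI2)
    fix F :: "('b ^ 'n) set" assume "F \<in> {F. F \<subseteq> UNIV \<and> finite F}"
    then have "finite F" by simp
    define B where "B = (\<Union>k. (\<lambda>x. x $ k) ` F)"
    have "finite B"
      using \<open>finite F\<close> by (simp add: B_def)
    have "(\<Sum>x\<in>F. \<Prod>k\<in>UNIV. a (x $ k)) = (\<Sum>h\<in>vec_nth ` F. \<Prod>k\<in>UNIV. a (h k))"
      by (subst sum.reindex) (auto simp: inj_on_def vec_nth_inject)
    also have "\<dots> \<le> (\<Sum>h\<in>PiE (UNIV::'n set) (\<lambda>_. B). \<Prod>k\<in>UNIV. a (h k))"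
    proof (rule sum_mono2)
      show "finite (PiE (UNIV::'n set) (\<lambda>_. B))"
        using \<open>finite B\<close> by (simp add: finite_PiE)
      show "vec_nth ` F \<subseteq> PiE UNIV (\<lambda>_. B)"
        by (auto simp: B_def)
    qed (intro prod_nonneg nonneg)
    also have "\<dots> = (\<Prod>k\<in>(UNIV::'n set). \<Sum>m\<in>B. a m)"
      using \<open>finite B\<close> by (subst prod_sum_PiE) auto
    also have "\<dots> \<le> (\<Prod>k\<in>(UNIV::'n set). infsum a UNIV)"
      using \<open>finite B\<close> assms
      by (intro prod_mono conjI sum_nonneg finite_sum_le_infsum) auto
    finally show "(\<Sum>x\<in>F. \<Prod>k\<in>UNIV. a (x $ k)) \<le> (\<Prod>k\<in>(UNIV::'n set). infsum a UNIV)" .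
  qed
qed

lemma lattice_norm_0 [simp]: "lattice_norm 0 = 0"
  by (simp add: lattice_norm_def vec_eq_iff flip: zero_vec_def)

lemma lattice_norm_minus: "lattice_norm (- x) = lattice_norm x"
proof -
  have "(\<chi> k. real_of_int ((- x) $ k)) = - (\<chi> k. real_of_int (x $ k))"
    by (simp add: vec_eq_iff)
  then show ?thesis
    by (metis lattice_norm_def norm_minus_cancel)
qed

lemma lattice_norm_component: "\<bar>real_of_int (x $ k)\<bar> \<le> lattice_norm x"
  using component_le_norm_cart[of "\<chi> k. real_of_int (x $ k)" k] by (simp add: lattice_norm_def)

lemma lattice_norm_ge_1:
  assumes "x \<noteq> 0"
  shows "1 \<le> lattice_norm x"
proof -
  obtain k where "x $ k \<noteq> 0"
    using assms by (auto simp: vec_eq_iff)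
  then have "1 \<le> \<bar>real_of_int (x $ k)\<bar>"
    by linarith
  with lattice_norm_component[of x k] show ?thesis
    by linarith
qed

text \<open>
  For nonzero \<open>x\<close> every factor \<open>1 + \<bar>x $ k\<bar>\<close> is at most \<open>2 * lattice_norm x\<close>. Distributing the power \<open>- p\<close>
  evenly over the \<open>N\<close> components bounds \<open>lattice_norm x powr (- p)\<close> by a product of
  one-dimensional terms with exponent \<open>- p / N < - 1\<close>. The term at 0 is \<open>0 powr (- p) = 0\<close>.
\<close>
lemma lattice_norm_powr_summable:
  assumes "p > real CARD('n::finite)"
  shows "(\<lambda>x::int ^ 'n. lattice_norm x powr (- p)) summable_on UNIV"
proof -
  define N where "N = real CARD('n)"
  have N: "N > 0" "p / N > 1"
    using assms by (simp_all add: N_def field_simps)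
  define a where "a m = (1 + \<bar>real_of_int m\<bar>) powr (- (p / N))" for m :: int
  have "(\<lambda>x::int ^ 'n. \<Prod>k\<in>UNIV. a (x $ k)) summable_on UNIV"
    using int_powr_summable[OF N(2)] by (intro summable_on_vec_prod) (simp_all add: a_def)
  then have "(\<lambda>x::int ^ 'n. 2 powr p * (\<Prod>k\<in>UNIV. a (x $ k))) summable_on UNIV"
    by (rule summable_on_cmult_right)
  then show ?thesis
  proof (rule summable_on_comparison_test)
    fix x :: "int ^ 'n"
    show "lattice_norm x powr (- p) \<le> 2 powr p * (\<Prod>k\<in>UNIV. a (x $ k))"
    proof (cases "x = 0")
      case True
      then show ?thesis by (simp add: prod_nonneg a_def)
    next
      case False
      let ?L = "lattice_norm x"
      have L: "1 \<le> ?L"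
        using False by (rule lattice_norm_ge_1)
      have "?L powr (- p) = 2 powr p * (2 * ?L) powr (- p)"
        by (simp add: powr_mult powr_minus field_simps)
      also have "(2 * ?L) powr (- p) = (\<Prod>k\<in>(UNIV::'n set). (2 * ?L) powr (- (p / N)))"
        using N L by (simp add: N_def powr_power)
      also have "\<dots> \<le> (\<Prod>k\<in>UNIV. a (x $ k))"
      proof (rule prod_mono)
        fix k :: 'n
        have "1 + \<bar>real_of_int (x $ k)\<bar> \<le> 2 * ?L"
          using lattice_norm_component[of x k] L by linarith
        then show "0 \<le> (2 * ?L) powr (- (p / N)) \<and> (2 * ?L) powr (- (p / N)) \<le> a (x $ k)"
          using N by (auto simp: a_def intro!: powr_mono2')
      qed
      finally show ?thesis by simp
    qed
  qed simp
qed

section \<open>Sequence spaces\<close>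

lemma abs_powr: "\<bar>x\<bar> powr p = x powr p" for x p :: real
  by (cases "x \<ge> 0") (simp_all add: uminus_powr_eq abs_if)

lemma lp_norm_nonneg [simp]: "0 \<le> lp_norm p f"
  by (simp add: lp_norm_def)

lemma has_sum_lp_norm:
  assumes "f \<in> lp_space p" "p > 0"
  shows "((\<lambda>i. \<bar>f i\<bar> powr p) has_sum lp_norm p f powr p) UNIV"
proof -
  have "lp_norm p f powr p = (\<Sum>\<^sub>\<infinity>i. \<bar>f i\<bar> powr p)"
    using assms by (simp add: lp_norm_def powr_powr infsum_nonneg)
  then show ?thesis
    using assms by (simp add: lp_space_def)
qed

lemma lp_norm_eqI:
  assumes "((\<lambda>i. \<bar>f i\<bar> powr p) has_sum S) UNIV"
  shows "f \<in> lp_space p" "lp_norm p f = S powr (1 / p)"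
  using assms by (auto simp: lp_space_def lp_norm_def has_sum_imp_summable infsumI)

lemma lp_norm_cong_bij:
  assumes "bij h"
  shows "(\<lambda>i. f (h i)) \<in> lp_space p \<longleftrightarrow> f \<in> lp_space p" "lp_norm p (\<lambda>i. f (h i)) = lp_norm p f"
  using summable_on_reindex_bij_betw[OF assms, of "\<lambda>i. \<bar>f i\<bar> powr p"]
    infsum_reindex_bij_betw[OF assms, of "\<lambda>i. \<bar>f i\<bar> powr p"]
  by (simp_all add: lp_space_def lp_norm_def)

lemma lp_abs [simp]:
  "(\<lambda>i. \<bar>f i\<bar>) \<in> lp_space p \<longleftrightarrow> f \<in> lp_space p" "lp_norm p (\<lambda>i. \<bar>f i\<bar>) = lp_norm p f"
  by (simp_all add: lp_space_def lp_norm_def)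

lemma lp_cmult:
  assumes "f \<in> lp_space p" "p > 0"
  shows "(\<lambda>i. c * f i) \<in> lp_space p" "lp_norm p (\<lambda>i. c * f i) = \<bar>c\<bar> * lp_norm p f"
proof -
  have "((\<lambda>i. \<bar>c * f i\<bar> powr p) has_sum (\<bar>c\<bar> * lp_norm p f) powr p) UNIV"
    using has_sum_cmult_right[OF has_sum_lp_norm[OF assms], of "\<bar>c\<bar> powr p"]
    by (simp add: abs_mult powr_mult)
  from lp_norm_eqI[OF this]
  show "(\<lambda>i. c * f i) \<in> lp_space p" "lp_norm p (\<lambda>i. c * f i) = \<bar>c\<bar> * lp_norm p f"
    using assms by (simp_all add: powr_powr)
qed

lemma abs_le_lp_norm:
  assumes "f \<in> lp_space p" "p > 0"
  shows "\<bar>f i\<bar> \<le> lp_norm p f"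
proof (rule ccontr)
  assume "\<not> \<bar>f i\<bar> \<le> lp_norm p f"
  then have "lp_norm p f powr p < \<bar>f i\<bar> powr p"
    using assms by (intro powr_less_mono2) auto
  moreover have "\<bar>f i\<bar> powr p \<le> lp_norm p f powr p"
    using finite_sum_le_has_sum[OF has_sum_lp_norm[OF assms], of "{i}"] by simp
  ultimately show False by simp
qed

lemma lp_space_mono:
  assumes "f \<in> lp_space p" "0 < p" "p \<le> q"
  shows "f \<in> lp_space q"
proof -
  let ?M = "lp_norm p f"
  have "(\<lambda>i. ?M powr (q - p) * \<bar>f i\<bar> powr p) summable_on UNIV"
    using assms by (intro summable_on_cmult_right) (simp add: lp_space_def)
  then have "(\<lambda>i. \<bar>f i\<bar> powr q) summable_on UNIV"
  proof (rule summable_on_comparison_test)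
    fix i
    have "\<bar>f i\<bar> powr q = \<bar>f i\<bar> powr (q - p) * \<bar>f i\<bar> powr p"
      by (simp flip: powr_add)
    also have "\<dots> \<le> ?M powr (q - p) * \<bar>f i\<bar> powr p"
      using assms by (intro mult_right_mono powr_mono2 abs_le_lp_norm) auto
    finally show "\<bar>f i\<bar> powr q \<le> ?M powr (q - p) * \<bar>f i\<bar> powr p" .
  qed simp
  then show ?thesis
    by (simp add: lp_space_def)
qed

lemma lp_delta:
  assumes "p > 0"
  shows "(\<lambda>x. if x = a then 1 else 0) \<in> lp_space p" "lp_norm p (\<lambda>x. if x = a then 1 else 0) = 1"
proof -
  have "((\<lambda>i. \<bar>if i = a then 1 else 0\<bar> powr p) has_sum 1) UNIV"
    by (rule has_sum_finite_neutralI[of "{a}"]) auto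
  from lp_norm_eqI[OF this]
  show "(\<lambda>x. if x = a then 1 else 0) \<in> lp_space p" "lp_norm p (\<lambda>x. if x = a then 1 else 0) = 1"
    by simp_all
qed

lemma has_sum_fun_upd:
  fixes u :: "'a \<Rightarrow> real"
  assumes "(u has_sum S) UNIV"
  shows "(u(i := y) has_sum (S - u i + y)) UNIV"
proof -
  have "((\<lambda>j. if j = i then y - u i else 0) has_sum (y - u i)) UNIV"
    by (rule has_sum_finite_neutralI[of "{i}"]) auto
  from has_sum_add[OF assms this] show ?thesis
    by (rule back_subst[where P = "\<lambda>v. (v has_sum _) _", THEN back_subst[where P = "\<lambda>S. (_ has_sum S) _"]])
       (auto simp: fun_eq_iff)
qed

lemma lp_fun_upd:
  assumes "f \<in> lp_space p" "p > 0"
  shows "f(i := y) \<in> lp_space p"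
    "lp_norm p (f(i := y)) = (lp_norm p f powr p - \<bar>f i\<bar> powr p + \<bar>y\<bar> powr p) powr (1 / p)"
proof -
  have "(\<lambda>j. \<bar>(f(i := y)) j\<bar> powr p) = (\<lambda>j. \<bar>f j\<bar> powr p)(i := \<bar>y\<bar> powr p)"
    by auto
  then have "((\<lambda>j. \<bar>(f(i := y)) j\<bar> powr p) has_sum (lp_norm p f powr p - \<bar>f i\<bar> powr p + \<bar>y\<bar> powr p)) UNIV"
    using has_sum_fun_upd[OF has_sum_lp_norm[OF assms]] by simp
  from lp_norm_eqI[OF this]
  show "f(i := y) \<in> lp_space p"
    "lp_norm p (f(i := y)) = (lp_norm p f powr p - \<bar>f i\<bar> powr p + \<bar>y\<bar> powr p) powr (1 / p)" .
qed

section \<open>Inequalities of Young type\<close>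

text \<open>
  By homogeneity the weighted mean \<open>S\<close> may be taken as 1, and then \<open>ln v \<le> v - 1\<close> suffices.
\<close>
lemma weighted_arith_geo_mean_3:
  fixes a b c x y z :: real
  assumes "a > 0" "b > 0" "c > 0" "a + b + c = 1" "x > 0" "y > 0" "z > 0"
  shows "x powr a * y powr b * z powr c \<le> a * x + b * y + c * z"
proof -
  define S where "S = a * x + b * y + c * z"
  have "S > 0"
    using assms by (simp add: S_def add_pos_pos)
  have ln_le: "ln v \<le> v / S - 1 + ln S" if "v > 0" for v
    using ln_le_minus_one[of "v / S"] that \<open>S > 0\<close> by (simp add: ln_div)
  have "a * ln x + b * ln y + c * ln z
      \<le> a * (x / S - 1 + ln S) + b * (y / S - 1 + ln S) + c * (z / S - 1 + ln S)"
    using assms by (intro add_mono mult_left_mono ln_le) auto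
  also have "\<dots> = (a * x + b * y + c * z) / S - (a + b + c) + (a + b + c) * ln S"
    by (simp add: algebra_simps add_divide_distrib)
  also have "\<dots> = ln S"
    using assms \<open>S > 0\<close> by (simp add: S_def)
  finally have "exp (a * ln x + b * ln y + c * ln z) \<le> S"
    using \<open>S > 0\<close> by (simp flip: ln_ge_iff)
  then show ?thesis
    using assms by (simp add: powr_def exp_add S_def)
qed

lemma has_sum_product_nonneg:
  fixes u :: "'a \<Rightarrow> real" and v :: "'b \<Rightarrow> real"
  assumes u: "(u has_sum U) UNIV" and v: "(v has_sum V) UNIV"
    and "\<And>x. 0 \<le> u x" "\<And>y. 0 \<le> v y"
  shows "((\<lambda>(x, y). u x * v y) has_sum U * V) UNIV"
proof -
  have inner: "((\<lambda>y. case (x, y) of (x, y) \<Rightarrow> u x * v y) has_sum u x * V) UNIV" for x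
    using has_sum_cmult_right[OF v] by simp
  have outer: "((\<lambda>x. u x * V) has_sum U * V) UNIV"
    by (rule has_sum_cmult_left[OF u])
  have "(\<lambda>(x, y). u x * v y) summable_on (UNIV \<times> UNIV)"
    by (rule summable_on_SigmaI[OF inner has_sum_imp_summable[OF outer]]) (use assms in auto)
  from has_sum_SigmaI[OF inner outer this] show ?thesis
    by simp
qed

text \<open>
  Young's inequality for \<open>d * a\<close> and \<open>w / d\<close> with \<open>d powr s = c\<close>: the weight of \<open>a\<close> can be made
  as small as required, at the cost of \<open>w\<close>. This makes tails small uniformly over a unit ball.
\<close>
lemma young_with_weight:
  fixes s c :: real
  assumes "s > 1" "c > 0"
  obtains C where "C > 0" "\<And>a w. 0 \<le> a \<Longrightarrow> 0 \<le> w \<Longrightarrow> a * w \<le> c * a powr s + C * w powr (s / (s - 1))"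
proof
  define t where "t = s / (s - 1)"
  have t: "t > 1" "1 / s + 1 / t = 1"
    using assms by (auto simp: t_def field_simps)
  define d where "d = c powr (1 / s)"
  have d: "d > 0" "d powr s = c"
    using assms by (simp_all add: d_def powr_powr)
  show "d powr (- t) > 0"
    using d by simp
  show "a * w \<le> c * a powr s + d powr (- t) * w powr (s / (s - 1))" if "0 \<le> a" "0 \<le> w" for a w
  proof -
    have "a * w = (d * a) * (w / d)"
      using d by simp
    also have "\<dots> \<le> (d * a) powr s / s + (w / d) powr t / t"
      using assms t d that by (intro Youngs_inequality) auto
    also have "\<dots> \<le> (d * a) powr s / 1 + (w / d) powr t / 1"
      using assms t by (intro add_mono divide_left_mono) auto
    also have "\<dots> = c * a powr s + d powr (- t) * w powr t"
      using d by (simp add: powr_mult powr_divide powr_minus field_simps)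
    finally show ?thesis
      by (simp add: t_def)
  qed
qed

section \<open>Convolution forms\<close>

definition conv_form :: "('a::ab_group_add \<Rightarrow> real) \<Rightarrow> ('a \<Rightarrow> real) \<Rightarrow> ('a \<Rightarrow> real) \<Rightarrow> real" where
  "conv_form k f g = (\<Sum>\<^sub>\<infinity>(i, j). f i * g j * k (i - j))"

definition conv_summable :: "('a::ab_group_add \<Rightarrow> real) \<Rightarrow> ('a \<Rightarrow> real) \<Rightarrow> ('a \<Rightarrow> real) \<Rightarrow> bool" where
  "conv_summable k f g \<longleftrightarrow> (\<lambda>(i, j). f i * g j * k (i - j)) summable_on UNIV"

lemma has_sum_conv_form:
  "conv_summable k f g \<Longrightarrow> ((\<lambda>(i, j). f i * g j * k (i - j)) has_sum conv_form k f g) UNIV"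
  by (simp add: conv_summable_def conv_form_def)

lemma conv_formI:
  assumes "((\<lambda>(i, j). f i * g j * k (i - j)) has_sum S) UNIV"
  shows "conv_summable k f g" "conv_form k f g = S"
  using assms by (auto simp: conv_summable_def conv_form_def has_sum_imp_summable infsumI)

lemma conv_form_commute:
  assumes "\<And>x. k (- x) = k x"
  shows "conv_summable k f g \<longleftrightarrow> conv_summable k g f" "conv_form k f g = conv_form k g f"
proof -
  have k: "k (a - b) = k (b - a)" for a b
    using assms[of "a - b"] by simp
  have bij: "bij_betw prod.swap (UNIV :: ('a \<times> 'a) set) UNIV"
    by simp
  have eq: "(\<lambda>x. (case prod.swap x of (i, j) \<Rightarrow> f i * g j * k (i - j))) = (\<lambda>(i, j). g i * f j * k (i - j))"
    by (auto simp: fun_eq_iff k[of "snd _"] k)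
  show "conv_summable k f g \<longleftrightarrow> conv_summable k g f" "conv_form k f g = conv_form k g f"
    using summable_on_reindex_bij_betw[OF bij, of "\<lambda>(i, j). f i * g j * k (i - j)"]
      infsum_reindex_bij_betw[OF bij, of "\<lambda>(i, j). f i * g j * k (i - j)"]
    unfolding eq by (simp_all add: conv_summable_def conv_form_def)
qed

lemma conv_form_translate: "conv_form k (\<lambda>i. f (i + a)) (\<lambda>j. g (j + a)) = conv_form k f g"
proof -
  have "bij_betw (\<lambda>(i, j). (i + a, j + a)) UNIV UNIV"
    by (rule bij_betw_byWitness[where f' = "\<lambda>(i, j). (i - a, j - a)"]) auto
  from infsum_reindex_bij_betw[OF this, of "\<lambda>(i, j). f i * g j * k (i - j)"] show ?thesis
    by (simp add: conv_form_def case_prod_unfold)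
qed

lemma conv_form_cmult:
  assumes "conv_summable k f g"
  shows "conv_form k (\<lambda>i. a * f i) (\<lambda>j. b * g j) = a * b * conv_form k f g"
proof -
  have "((\<lambda>(i, j). (a * f i) * (b * g j) * k (i - j)) has_sum a * b * conv_form k f g) UNIV"
    using has_sum_cmult_right[OF has_sum_conv_form[OF assms], of "a * b"]
    by (simp add: case_prod_unfold algebra_simps)
  then show ?thesis
    by (rule conv_formI)
qed

lemma conv_form_mono:
  assumes "conv_summable k f g" "conv_summable k f' g'"
    and "\<And>x. 0 \<le> k x" "\<And>i j. f i * g j \<le> f' i * g' j"
  shows "conv_form k f g \<le> conv_form k f' g'"
  using assms unfolding conv_form_def conv_summable_def
  by (intro infsum_mono) (auto intro: mult_right_mono)

text \<open>
  The form is affine in a single value of \<open>f\<close>, with slope the convolution of \<open>g\<close> and \<open>k\<close> there.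
\<close>
lemma conv_form_fun_upd:
  assumes fg: "conv_summable k f g" and h: "((\<lambda>j. g j * k (i - j)) has_sum h) UNIV"
  shows "conv_form k (f(i := f i + t)) g = conv_form k f g + t * h"
proof -
  have "((\<lambda>j. t * (g j * k (i - j))) has_sum t * h) UNIV"
    by (rule has_sum_cmult_right[OF h])
  also have "?this \<longleftrightarrow> ((\<lambda>(x, j). t * (g j * k (x - j))) has_sum t * h) ((\<lambda>j. (i, j)) ` UNIV)"
    by (subst has_sum_reindex) (auto simp: inj_on_def o_def)
  also have "\<dots> \<longleftrightarrow> ((\<lambda>(x, j). if x = i then t * (g j * k (x - j)) else 0) has_sum t * h) UNIV"
    by (rule has_sum_cong_neutral) auto
  finally have "((\<lambda>(x, j). if x = i then t * (g j * k (x - j)) else 0) has_sum t * h) UNIV" .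
  from has_sum_add[OF has_sum_conv_form[OF fg] this]
  have "((\<lambda>(x, j). (f(i := f i + t)) x * g j * k (x - j)) has_sum conv_form k f g + t * h) UNIV"
    by (rule back_subst[where P = "\<lambda>v. (v has_sum _) _"]) (auto simp: fun_eq_iff algebra_simps)
  then show ?thesis
    by (rule conv_formI)
qed

section \<open>Passing to the limit in the first-order condition\<close>

lemma conjugate_exponents_summable:
  fixes a w :: "'a \<Rightarrow> real"
  assumes "s > 1" "\<And>j. 0 \<le> a j" "\<And>j. 0 \<le> w j"
    and a: "(\<lambda>j. a j powr s) summable_on UNIV" and w: "(\<lambda>j. w j powr (s / (s - 1))) summable_on UNIV"
  shows "(\<lambda>j. a j * w j) summable_on UNIV"
proof -
  obtain C where C: "C > 0"
      "\<And>a w. 0 \<le> a \<Longrightarrow> 0 \<le> w \<Longrightarrow> a * w \<le> 1 * a powr s + C * w powr (s / (s - 1))"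
    using young_with_weight[of s 1] assms(1) zero_less_one by metis
  have "(\<lambda>j. 1 * a j powr s + C * w j powr (s / (s - 1))) summable_on UNIV"
    by (intro summable_on_add summable_on_cmult_right a w)
  then show ?thesis
    by (rule summable_on_comparison_test) (use assms C in auto)
qed

text \<open>
  Fatou's lemma: the bound 1 for every finite partial sum passes to the limit.
\<close>
lemma pointwise_limit_lp:
  fixes G :: "nat \<Rightarrow> 'a \<Rightarrow> real"
  assumes "s > 0" and G: "\<And>n. G n \<in> lp_space s" "\<And>n. lp_norm s (G n) \<le> 1"
    and lim: "\<And>j. (\<lambda>n. G n j) \<longlonglongrightarrow> g j"
  shows "g \<in> lp_space s" "lp_norm s g \<le> 1"
proof -
  have finite_le: "(\<Sum>j\<in>F. \<bar>g j\<bar> powr s) \<le> 1" if "finite F" for F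
  proof (rule LIMSEQ_le_const2)
    show "(\<lambda>n. \<Sum>j\<in>F. \<bar>G n j\<bar> powr s) \<longlonglongrightarrow> (\<Sum>j\<in>F. \<bar>g j\<bar> powr s)"
      using assms(1) by (intro tendsto_sum tendsto_powr2 tendsto_rabs lim tendsto_const) auto
    have "(\<Sum>j\<in>F. \<bar>G n j\<bar> powr s) \<le> lp_norm s (G n) powr s" for n
      using that by (intro finite_sum_le_has_sum[OF has_sum_lp_norm[OF G(1) assms(1)]]) auto
    also have "lp_norm s (G n) powr s \<le> 1" for n
      using assms(1) G(2)[of n] by (intro powr_le1) auto
    finally show "\<exists>N. \<forall>n\<ge>N. (\<Sum>j\<in>F. \<bar>G n j\<bar> powr s) \<le> 1" by blast
  qed
  show lp: "g \<in> lp_space s"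
    unfolding lp_space_def mem_Collect_eq
    by (rule nonneg_bdd_above_summable_on) (auto intro!: bdd_aboveI2 finite_le)
  have "(\<Sum>\<^sub>\<infinity>j. \<bar>g j\<bar> powr s) \<le> 1"
    using lp by (intro infsum_le_finite_sums finite_le) (auto simp: lp_space_def)
  then show "lp_norm s g \<le> 1"
    using assms(1) by (auto simp: lp_norm_def infsum_nonneg intro!: powr_le1)
qed

text \<open>
  Pointwise convergence of nonnegative functions in the unit ball of \<open>lp_space s\<close> implies weak convergence: outside a
  finite set \<open>B\<close> that carries almost all of the conjugate norm of \<open>w\<close>, the pairing with \<open>w\<close> is small
  uniformly in the unit ball, and on \<open>B\<close> the convergence is elementary.
\<close>
lemma infsum_tendsto_conjugate:
  fixes G :: "nat \<Rightarrow> 'a \<Rightarrow> real"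
  assumes s: "s > 1" and G: "\<And>n. G n \<in> lp_space s" "\<And>n. lp_norm s (G n) \<le> 1"
    and G_nonneg: "\<And>n j. 0 \<le> G n j" and w_nonneg: "\<And>j. 0 \<le> w j"
    and w: "w \<in> lp_space (s / (s - 1))"
    and lim: "\<And>j. (\<lambda>n. G n j) \<longlonglongrightarrow> g j"
  shows "(\<lambda>n. \<Sum>\<^sub>\<infinity>j. G n j * w j) \<longlonglongrightarrow> (\<Sum>\<^sub>\<infinity>j. g j * w j)"
    and "(\<lambda>j. g j * w j) summable_on UNIV"
proof -
  note g = pointwise_limit_lp[OF _ G lim]
  have g_nonneg: "0 \<le> g j" for j
    using lim by (rule LIMSEQ_le_const) (use G_nonneg in auto)
  have w': "(\<lambda>j. w j powr (s / (s - 1))) summable_on UNIV"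
    using w w_nonneg by (simp add: lp_space_def)
  have summable: "(\<lambda>j. a j * w j) summable_on UNIV"
    if "a \<in> lp_space s" "\<And>j. 0 \<le> a j" for a
    using that s w_nonneg w' by (intro conjugate_exponents_summable) (auto simp: lp_space_def)
  show g_summable: "(\<lambda>j. g j * w j) summable_on UNIV"
    using summable g g_nonneg s by auto
  show "(\<lambda>n. \<Sum>\<^sub>\<infinity>j. G n j * w j) \<longlonglongrightarrow> (\<Sum>\<^sub>\<infinity>j. g j * w j)"
  proof (rule LIMSEQ_I)
    fix e :: real assume "e > 0"
    \<comment> \<open>Each of the two tails gets \<open>e / 4\<close>: half from the weight \<open>e / 8\<close>, half from the choice of \<open>B\<close>.\<close>
    obtain C where C: "C > 0"
      "\<And>a w. 0 \<le> a \<Longrightarrow> 0 \<le> w \<Longrightarrow> a * w \<le> (e / 8) * a powr s + C * w powr (s / (s - 1))"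
      using young_with_weight[of s "e / 8"] s \<open>e > 0\<close> by (metis zero_less_divide_iff zero_less_numeral)
    obtain B where B: "finite B"
        "dist (\<Sum>j\<in>B. w j powr (s / (s - 1))) (\<Sum>\<^sub>\<infinity>j. w j powr (s / (s - 1))) \<le> e / (8 * C)"
      using has_sum_finite_approximation[OF has_sum_infsum[OF w'], of "e / (8 * C)"] C \<open>e > 0\<close> by auto
    have w_tail: "(\<Sum>\<^sub>\<infinity>j\<in>-B. w j powr (s / (s - 1))) \<le> e / (8 * C)"
    proof -
      have "(\<Sum>\<^sub>\<infinity>j\<in>UNIV - B. w j powr (s / (s - 1)))
          = (\<Sum>\<^sub>\<infinity>j. w j powr (s / (s - 1))) - (\<Sum>j\<in>B. w j powr (s / (s - 1)))"
        using w' B(1) by (subst infsum_Diff) auto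
      then show ?thesis
        using B(2) by (simp add: dist_real_def Compl_eq_Diff_UNIV)
    qed
    have tail: "0 \<le> (\<Sum>\<^sub>\<infinity>j\<in>-B. a j * w j) \<and> (\<Sum>\<^sub>\<infinity>j\<in>-B. a j * w j) \<le> e / 4"
      if a: "a \<in> lp_space s" "lp_norm s a \<le> 1" "\<And>j. 0 \<le> a j" for a
    proof
      show "0 \<le> (\<Sum>\<^sub>\<infinity>j\<in>-B. a j * w j)"
        using a w_nonneg by (intro infsum_nonneg) auto
      have a_sum: "((\<lambda>j. a j powr s) has_sum lp_norm s a powr s) UNIV"
        using has_sum_lp_norm[OF a(1)] s a(3) by simp
      have a_on: "(\<lambda>j. a j powr s) summable_on A" and w_on: "(\<lambda>j. w j powr (s / (s - 1))) summable_on A"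
        for A
        using a_sum w' by (auto intro: summable_on_subset_banach has_sum_imp_summable)
      have "(\<Sum>\<^sub>\<infinity>j\<in>-B. a j powr s) \<le> lp_norm s a powr s"
        using has_sum_mono2[OF has_sum_infsum[OF a_on] a_sum] by simp
      also have "\<dots> \<le> 1"
        using a s by (intro powr_le1) auto
      finally have a_le: "(\<Sum>\<^sub>\<infinity>j\<in>-B. a j powr s) \<le> 1" .
      have "(\<Sum>\<^sub>\<infinity>j\<in>-B. a j * w j) \<le> (\<Sum>\<^sub>\<infinity>j\<in>-B. (e / 8) * a j powr s + C * w j powr (s / (s - 1)))"
        using C a w_nonneg summable[OF a(1,3)]
        by (intro infsum_mono summable_on_add summable_on_cmult_right a_on w_on)
           (auto intro: summable_on_subset_banach)
      also have "\<dots> = (e / 8) * (\<Sum>\<^sub>\<infinity>j\<in>-B. a j powr s) + C * (\<Sum>\<^sub>\<infinity>j\<in>-B. w j powr (s / (s - 1)))"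
        using infsum_add[OF summable_on_cmult_right[OF a_on[of "- B"]]
              summable_on_cmult_right[OF w_on[of "- B"]], of "e / 8" C]
        by (simp only: infsum_cmult_right')
      also have "\<dots> \<le> (e / 8) * 1 + C * (e / (8 * C))"
        using a_le w_tail C \<open>e > 0\<close> by (intro add_mono mult_left_mono) auto
      also have "\<dots> = e / 4"
        using C by simp
      finally show "(\<Sum>\<^sub>\<infinity>j\<in>-B. a j * w j) \<le> e / 4" .
    qed
    have split: "(\<Sum>\<^sub>\<infinity>j. a j * w j) = (\<Sum>j\<in>B. a j * w j) + (\<Sum>\<^sub>\<infinity>j\<in>-B. a j * w j)"
      if "(\<lambda>j. a j * w j) summable_on UNIV" for a
      using that B(1) by (simp add: Compl_eq_Diff_UNIV infsum_Diff)
    have "(\<lambda>n. \<Sum>j\<in>B. G n j * w j) \<longlonglongrightarrow> (\<Sum>j\<in>B. g j * w j)"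
      by (intro tendsto_sum tendsto_mult_right lim)
    from LIMSEQ_D[OF this, of "e / 4"] obtain n0 where n0: "\<And>n. n \<ge> n0 \<Longrightarrow> norm ((\<Sum>j\<in>B. G n j * w j) - (\<Sum>j\<in>B. g j * w j)) < e / 4"
      using \<open>e > 0\<close> by auto
    have "norm ((\<Sum>\<^sub>\<infinity>j. G n j * w j) - (\<Sum>\<^sub>\<infinity>j. g j * w j)) < e" if "n \<ge> n0" for n
    proof -
      have "0 \<le> (\<Sum>\<^sub>\<infinity>j\<in>-B. G n j * w j)" "(\<Sum>\<^sub>\<infinity>j\<in>-B. G n j * w j) \<le> e / 4"
        using tail[OF G(1,2)[of n] G_nonneg] by simp_all
      moreover have "0 \<le> (\<Sum>\<^sub>\<infinity>j\<in>-B. g j * w j)" "(\<Sum>\<^sub>\<infinity>j\<in>-B. g j * w j) \<le> e / 4"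
        using tail[OF g g_nonneg] s by simp_all
      ultimately show ?thesis
        using n0[OF that] \<open>e > 0\<close>
        unfolding split[OF summable[OF G(1)[of n] G_nonneg]] split[OF g_summable] real_norm_def
        by linarith
    qed
    then show "\<exists>n0. \<forall>n\<ge>n0. norm ((\<Sum>\<^sub>\<infinity>j. G n j * w j) - (\<Sum>\<^sub>\<infinity>j. g j * w j)) < e" by blast
  qed
qed

text \<open>
  Since \<open>t powr p = \<bar>t\<bar> powr p\<close> for real \<open>t\<close>, the function is defined and differentiable at 0
  as well. There the derivative is 0 because \<open>p > 1\<close>.
\<close>
lemma powr_has_real_derivative:
  assumes "p > 1" "0 \<le> x"
  shows "((\<lambda>t. t powr p) has_real_derivative p * x powr (p - 1)) (at x)"
proof (cases "x = 0")
  case True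
  have "((\<lambda>h::real. \<bar>h\<bar> powr (p - 1)) \<longlongrightarrow> 0 powr (p - 1)) (at 0)"
    using assms by (intro tendsto_powr2 tendsto_rabs_zero tendsto_ident_at tendsto_const) auto
  then have "((\<lambda>h::real. h powr (p - 1)) \<longlongrightarrow> 0) (at 0)"
    by (simp add: abs_powr)
  then have "((\<lambda>h::real. \<bar>h powr p / h\<bar>) \<longlongrightarrow> 0) (at 0)"
  proof (rule Lim_transform_eventually)
    show "\<forall>\<^sub>F h in at 0. h powr (p - 1) = \<bar>h powr p / h\<bar>"
      by (auto simp: eventually_at_filter powr_diff)
  qed
  then have "((\<lambda>h::real. h powr p / h) \<longlongrightarrow> 0) (at 0)"
    by (rule tendsto_rabs_zero_cancel)
  then show ?thesis
    using True assms by (simp add: DERIV_def)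
next
  case False
  then show ?thesis
    using assms by (intro has_real_derivative_powr) auto
qed

text \<open>
  Bernoulli's inequality: the graph of a concave power lies below its tangent at 1. It makes the
  bound for the perturbed norm linear in the perturbed sum of powers.
\<close>
lemma powr_inverse_le:
  fixes r y :: real
  assumes "r > 1" "0 \<le> y"
  shows "y powr (1 / r) \<le> 1 + (y - 1) / r"
proof (cases "y = 0")
  case False
  then show ?thesis
    using Youngs_inequality_0[of "1 / r" "1 - 1 / r" y 1] assms by (simp add: field_simps)
qed (use assms in auto)

text \<open>
  Perturbing \<open>F n\<close> at the single point \<open>i\<close> gives an inequality in which only quantities with a
  limit occur. In the limit the nonnegative function \<open>K / r * ((f i + t) powr r - f i powr r) - t * h\<close>
  of \<open>t\<close> vanishes at \<open>t = 0\<close>, so its derivative there is 0. The hypothesis on \<open>k\<close> is that it belongs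
  to the dual of \<open>lp_space s\<close>; the boundedness of the form enters only as an inequality, so that the lemma
  can be used with the two functions exchanged.
\<close>
lemma euler_lagrange_limit:
  fixes F G :: "nat \<Rightarrow> 'a::ab_group_add \<Rightarrow> real"
  assumes r: "r > 1" and s: "s > 1" and K: "K > 0"
    and k_nonneg: "\<And>x. 0 \<le> k x" and k_lp: "k \<in> lp_space (s / (s - 1))"
    and summable: "\<And>u v. u \<in> lp_space r \<Longrightarrow> v \<in> lp_space s \<Longrightarrow> conv_summable k u v"
    and bound: "\<And>u v. u \<in> lp_space r \<Longrightarrow> v \<in> lp_space s \<Longrightarrow>
      conv_form k u v \<le> K * lp_norm r u * lp_norm s v"
    and F: "\<And>n. F n \<in> lp_space r" "\<And>n. lp_norm r (F n) = 1" "\<And>n i. 0 \<le> F n i"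
    and G: "\<And>n. G n \<in> lp_space s" "\<And>n. lp_norm s (G n) = 1" "\<And>n i. 0 \<le> G n i"
    and maximizing: "(\<lambda>n. conv_form k (F n) (G n)) \<longlonglongrightarrow> K"
    and f: "\<And>i. (\<lambda>n. F n i) \<longlonglongrightarrow> f i" and g: "\<And>i. (\<lambda>n. G n i) \<longlonglongrightarrow> g i"
  shows "((\<lambda>j. g j * k (i - j)) has_sum K * f i powr (r - 1)) UNIV"
proof -
  have bij: "bij (\<lambda>j. i - j)"
    by (rule bij_betw_byWitness[where f' = "\<lambda>j. i - j"]) auto
  have w: "(\<lambda>j. k (i - j)) \<in> lp_space (s / (s - 1))"
    using k_lp lp_norm_cong_bij(1)[OF bij, of k] by simp
  have w': "(\<lambda>j. k (i - j) powr (s / (s - 1))) summable_on UNIV"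
    using w k_nonneg by (simp add: lp_space_def)
  define h where "h = (\<Sum>\<^sub>\<infinity>j. g j * k (i - j))"
  have h: "(\<lambda>n. \<Sum>\<^sub>\<infinity>j. G n j * k (i - j)) \<longlonglongrightarrow> h" "(\<lambda>j. g j * k (i - j)) summable_on UNIV"
    using infsum_tendsto_conjugate[OF s G(1) _ G(3) k_nonneg w g] G(2) by (auto simp: h_def)
  have perturb: "conv_form k (F n) (G n) + t * (\<Sum>\<^sub>\<infinity>j. G n j * k (i - j))
      \<le> K + K / r * (\<bar>F n i + t\<bar> powr r - F n i powr r)" for n t
  proof -
    let ?y = "1 - F n i powr r + \<bar>F n i + t\<bar> powr r"
    have Fi: "F n i powr r \<le> 1"
      using abs_le_lp_norm[OF F(1)[of n], of i] r F(2,3)[of n] by (intro powr_le1) auto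
    have u: "(F n)(i := F n i + t) \<in> lp_space r"
      "lp_norm r ((F n)(i := F n i + t)) = ?y powr (1 / r)"
      using lp_fun_upd[OF F(1)[of n], of i "F n i + t"] r F(2,3) by auto
    have "(\<lambda>j. G n j * k (i - j)) summable_on UNIV"
      using G(1,3) s k_nonneg w' by (intro conjugate_exponents_summable) (auto simp: lp_space_def)
    then have "conv_form k (F n) (G n) + t * (\<Sum>\<^sub>\<infinity>j. G n j * k (i - j))
        = conv_form k ((F n)(i := F n i + t)) (G n)"
      by (intro conv_form_fun_upd[symmetric] summable F G has_sum_infsum)
    also have "\<dots> \<le> K * ?y powr (1 / r)"
      using bound[OF u(1) G(1)[of n]] by (simp add: u G)
    also have "\<dots> \<le> K * (1 + (?y - 1) / r)"
      using K r Fi by (intro mult_left_mono powr_inverse_le) (auto intro: add_nonneg_nonneg)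
    also have "\<dots> = K + K / r * (\<bar>F n i + t\<bar> powr r - F n i powr r)"
      by (simp add: field_simps)
    finally show ?thesis .
  qed
  have f_nonneg: "0 \<le> f i"
    using f by (rule LIMSEQ_le_const) (use F in auto)
  have minimum: "0 \<le> K / r * ((f i + t) powr r - f i powr r) - t * h" for t
  proof -
    have "K + t * h \<le> K + K / r * (\<bar>f i + t\<bar> powr r - \<bar>f i\<bar> powr r)"
    proof (rule LIMSEQ_le)
      show "(\<lambda>n. conv_form k (F n) (G n) + t * (\<Sum>\<^sub>\<infinity>j. G n j * k (i - j))) \<longlonglongrightarrow> K + t * h"
        by (intro tendsto_intros maximizing h)
      show "(\<lambda>n. K + K / r * (\<bar>F n i + t\<bar> powr r - \<bar>F n i\<bar> powr r)) \<longlonglongrightarrow>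
          K + K / r * (\<bar>f i + t\<bar> powr r - \<bar>f i\<bar> powr r)"
        using r by (intro tendsto_add tendsto_diff tendsto_mult tendsto_powr2 tendsto_rabs f tendsto_const) auto
    qed (use perturb F in \<open>auto simp: abs_powr\<close>)
    then show ?thesis
      by (simp add: abs_powr)
  qed
  have "((\<lambda>x. x powr r) has_real_derivative r * f i powr (r - 1)) (at (0 + f i))"
    using powr_has_real_derivative[OF r f_nonneg] by simp
  then have "((\<lambda>t. (f i + t) powr r) has_real_derivative r * f i powr (r - 1)) (at 0)"
    unfolding DERIV_shift by (simp add: add.commute)
  then have "((\<lambda>t. K / r * ((f i + t) powr r - f i powr r) - t * h) has_real_derivative
      K / r * (r * f i powr (r - 1) - 0) - 1 * h) (at 0)"
    by (intro DERIV_diff DERIV_cmult DERIV_const DERIV_cmult_right DERIV_ident)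
  then have "K / r * (r * f i powr (r - 1) - 0) - 1 * h = 0"
    by (rule DERIV_local_min[OF _ zero_less_one]) (use minimum in auto)
  then have "h = K * f i powr (r - 1)"
    using r by simp
  then show ?thesis
    using has_sum_infsum[OF h(2)] by (simp add: h_def)
qed

section \<open>The Hardy-Littlewood-Sobolev inequality with room in the exponents\<close>

definition conv_const :: "('a::ab_group_add \<Rightarrow> real) \<Rightarrow> real \<Rightarrow> real \<Rightarrow> real" where
  "conv_const k r s = Sup {conv_form k f g | f g.
     f \<in> lp_space r \<and> g \<in> lp_space s \<and> lp_norm r f = 1 \<and> lp_norm s g = 1}"

lemma lp_norm_eq_0:
  assumes "f \<in> lp_space p" "p > 0" "lp_norm p f = 0"
  shows "f = (\<lambda>i. 0)"
  using abs_le_lp_norm[OF assms(1,2)] assms(3) by auto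

text \<open>
  The number \<open>\<theta>\<close> measures the room between the exponents. For \<open>\<theta> = 0\<close> the condition on \<open>k\<close> would be
  that of Young's convolution inequality, \<open>1/r + 1/s + 1/q = 2\<close>; for \<open>\<theta> > 0\<close> the exponent of \<open>k\<close> is
  smaller, so the condition is stronger.
\<close>
locale subcritical_kernel =
  fixes k :: "'a::ab_group_add \<Rightarrow> real" and r s \<theta> :: real
  assumes r: "r > 1" and s: "s > 1" and \<theta>: "0 < \<theta>" "\<theta> < 1"
    and exponent_sum: "(1 - \<theta>) / r + 1 / s > 1"
    and k_nonneg: "\<And>x. 0 \<le> k x"
    and k_lp: "k \<in> lp_space (1 / (2 - (1 - \<theta>) / r - 1 / s))"
begin

text \<open>
  The weights \<open>\<alpha>\<close>, \<open>\<beta>\<close>, \<open>\<gamma>\<close> are those with which \<open>f powr r * g powr s\<close>,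
  \<open>f powr r * k powr q\<close> and \<open>g powr s * k powr q\<close> have the geometric mean \<open>f powr (1 - \<theta>) * g * k\<close>.
\<close>
definition "\<beta> = 1 - 1 / s"
definition "\<gamma> = 1 - (1 - \<theta>) / r"
definition "\<alpha> = 1 - \<beta> - \<gamma>"
definition "q = 1 / (\<beta> + \<gamma>)"

lemma exponents:
  "\<alpha> > 0" "\<beta> > 0" "\<gamma> > 0" "\<alpha> + \<beta> + \<gamma> = 1" "q > 0"
  "r * (\<alpha> + \<beta>) = 1 - \<theta>" "s * (\<alpha> + \<gamma>) = 1" "q * (\<beta> + \<gamma>) = 1"
proof -
  show "\<beta> > 0"
    using s by (simp add: \<beta>_def)
  have "(1 - \<theta>) / r < 1"
    using r \<theta> by simp
  then show "\<gamma> > 0"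
    by (simp add: \<gamma>_def)
  with \<open>\<beta> > 0\<close> show "q > 0" "q * (\<beta> + \<gamma>) = 1"
    by (simp_all add: q_def)
  show "\<alpha> > 0"
    using exponent_sum by (simp add: \<alpha>_def \<beta>_def \<gamma>_def)
  show "\<alpha> + \<beta> + \<gamma> = 1" "r * (\<alpha> + \<beta>) = 1 - \<theta>" "s * (\<alpha> + \<gamma>) = 1"
    using r s by (simp_all add: \<alpha>_def \<beta>_def \<gamma>_def)
qed

lemma k_lp_q: "k \<in> lp_space q"
  using k_lp by (simp add: q_def \<beta>_def \<gamma>_def algebra_simps)

text \<open>
  The exponent \<open>q\<close> is at most both conjugate exponents, and the spaces increase with the exponent.
\<close>
lemma k_lp_conjugate: "k \<in> lp_space (r / (r - 1))" "k \<in> lp_space (s / (s - 1))"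
proof -
  have "1 - 1 / r \<le> \<gamma>"
    using r \<theta> by (simp add: \<gamma>_def divide_right_mono)
  then have "1 - 1 / r \<le> \<beta> + \<gamma>" "1 - 1 / s \<le> \<beta> + \<gamma>" "0 < 1 - 1 / r" "0 < 1 - 1 / s"
    using exponents(2,3) r s \<beta>_def by (simp_all, linarith)
  then have "q \<le> 1 / (1 - 1 / r)" "q \<le> 1 / (1 - 1 / s)"
    unfolding q_def by (intro frac_le; simp)+
  moreover have "1 / (1 - 1 / r) = r / (r - 1)" "1 / (1 - 1 / s) = s / (s - 1)"
    using r s by (simp_all add: field_simps)
  ultimately show "k \<in> lp_space (r / (r - 1))" "k \<in> lp_space (s / (s - 1))"
    using lp_space_mono[OF k_lp_q] exponents by auto
qed

text \<open>
  The factor \<open>u powr \<theta>\<close> is estimated by the bound \<open>M\<close> and the rest by the arithmetic mean. Each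
  of the three terms depends on only two of the factors, so after summation over \<open>(i, j)\<close> with
  \<open>u = \<bar>f i\<bar>\<close>, \<open>v = \<bar>g j\<bar>\<close> and \<open>w = k (i - j)\<close> it splits into a product of two sums.
\<close>
lemma weighted_term_bound:
  fixes u v w M :: real
  assumes "0 \<le> u" "u \<le> M" "0 \<le> v" "0 \<le> w"
  shows "u * v * w \<le> M powr \<theta> *
    (\<alpha> * (u powr r * v powr s) + \<beta> * (u powr r * w powr q) + \<gamma> * (v powr s * w powr q))"
proof (cases "u = 0 \<or> v = 0 \<or> w = 0")
  case True
  then show ?thesis
    using exponents by (auto intro!: mult_nonneg_nonneg add_nonneg_nonneg)
next
  case False
  then have pos: "u > 0" "v > 0" "w > 0"
    using assms by auto
  let ?X = "u powr r * v powr s" and ?Y = "u powr r * w powr q" and ?Z = "v powr s * w powr q"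
  have "?X powr \<alpha> * ?Y powr \<beta> * ?Z powr \<gamma>
      = u powr (r * (\<alpha> + \<beta>)) * v powr (s * (\<alpha> + \<gamma>)) * w powr (q * (\<beta> + \<gamma>))"
    by (simp add: powr_mult powr_powr powr_add distrib_left)
  also have "\<dots> = u powr (1 - \<theta>) * v * w"
    using pos by (simp add: exponents)
  finally have eq: "u powr (1 - \<theta>) * v * w = ?X powr \<alpha> * ?Y powr \<beta> * ?Z powr \<gamma>" by simp
  have "u * v * w = u powr \<theta> * (u powr (1 - \<theta>) * v * w)"
    using pos by (simp flip: powr_add mult.assoc)
  also have "\<dots> \<le> M powr \<theta> * (u powr (1 - \<theta>) * v * w)"
    using assms \<theta> by (intro mult_right_mono powr_mono2) auto
  also have "\<dots> \<le> M powr \<theta> * (\<alpha> * ?X + \<beta> * ?Y + \<gamma> * ?Z)"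
    unfolding eq using exponents pos by (intro mult_left_mono weighted_arith_geo_mean_3) auto
  finally show ?thesis .
qed

text \<open>
  Summation of the previous bound. The substitutions \<open>(i, j) \<mapsto> (i, i - j)\<close> and
  \<open>(i, j) \<mapsto> (j, i - j)\<close> turn the terms that contain \<open>k\<close> into products.
\<close>
lemma conv_bound:
  assumes f: "f \<in> lp_space r" and g: "g \<in> lp_space s" and M: "\<And>i. \<bar>f i\<bar> \<le> M"
  shows "conv_summable k f g"
    and "conv_summable k (\<lambda>i. \<bar>f i\<bar>) (\<lambda>j. \<bar>g j\<bar>)"
    and "conv_form k (\<lambda>i. \<bar>f i\<bar>) (\<lambda>j. \<bar>g j\<bar>) \<le> M powr \<theta> *
      (\<alpha> * (lp_norm r f powr r * lp_norm s g powr s)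
        + \<beta> * (lp_norm r f powr r * lp_norm q k powr q)
        + \<gamma> * (lp_norm s g powr s * lp_norm q k powr q))"
proof -
  let ?u = "\<lambda>i. \<bar>f i\<bar> powr r" and ?v = "\<lambda>j. \<bar>g j\<bar> powr s" and ?w = "\<lambda>x. k x powr q"
  have u: "(?u has_sum lp_norm r f powr r) UNIV" and v: "(?v has_sum lp_norm s g powr s) UNIV"
    using f g r s by (auto intro!: has_sum_lp_norm)
  have w: "(?w has_sum lp_norm q k powr q) UNIV"
    using has_sum_lp_norm[OF k_lp_q] exponents k_nonneg by simp
  have bij1: "bij_betw (\<lambda>(i, j). (i, i - j)) (UNIV :: ('a \<times> 'a) set) UNIV"
    by (rule bij_betw_byWitness[where f' = "\<lambda>(i, j). (i, i - j)"]) auto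
  have bij2: "bij_betw (\<lambda>(i, j). (j, i - j)) (UNIV :: ('a \<times> 'a) set) UNIV"
    by (rule bij_betw_byWitness[where f' = "\<lambda>(j, x). (x + j, j)"]) auto
  have uv: "((\<lambda>(i, j). ?u i * ?v j) has_sum (lp_norm r f powr r * lp_norm s g powr s)) UNIV"
    by (intro has_sum_product_nonneg u v) auto
  have "((\<lambda>(i, x). ?u i * ?w x) has_sum (lp_norm r f powr r * lp_norm q k powr q)) UNIV"
    by (intro has_sum_product_nonneg u w) auto
  then have uw: "((\<lambda>(i, j). ?u i * ?w (i - j)) has_sum (lp_norm r f powr r * lp_norm q k powr q)) UNIV"
    using has_sum_reindex_bij_betw[OF bij1, of "\<lambda>(i, x). ?u i * ?w x"] by (simp add: case_prod_unfold)
  have "((\<lambda>(j, x). ?v j * ?w x) has_sum (lp_norm s g powr s * lp_norm q k powr q)) UNIV"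
    by (intro has_sum_product_nonneg v w) auto
  then have vw: "((\<lambda>(i, j). ?v j * ?w (i - j)) has_sum (lp_norm s g powr s * lp_norm q k powr q)) UNIV"
    using has_sum_reindex_bij_betw[OF bij2, of "\<lambda>(j, x). ?v j * ?w x"] by (simp add: case_prod_unfold)
  let ?B = "\<lambda>(i, j). M powr \<theta> *
    (\<alpha> * (?u i * ?v j) + \<beta> * (?u i * ?w (i - j)) + \<gamma> * (?v j * ?w (i - j)))"
  have B: "(?B has_sum M powr \<theta> *
      (\<alpha> * (lp_norm r f powr r * lp_norm s g powr s)
        + \<beta> * (lp_norm r f powr r * lp_norm q k powr q)
        + \<gamma> * (lp_norm s g powr s * lp_norm q k powr q))) UNIV"
    using has_sum_cmult_right[OF has_sum_add[OF has_sum_add[OF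
        has_sum_cmult_right[OF uv] has_sum_cmult_right[OF uw]] has_sum_cmult_right[OF vw]]]
    by (simp add: case_prod_unfold)
  have le: "\<bar>f i\<bar> * \<bar>g j\<bar> * k (i - j) \<le> ?B (i, j)" for i j
    using weighted_term_bound[of "\<bar>f i\<bar>" M "\<bar>g j\<bar>" "k (i - j)"] M k_nonneg by simp
  show abs: "conv_summable k (\<lambda>i. \<bar>f i\<bar>) (\<lambda>j. \<bar>g j\<bar>)"
    unfolding conv_summable_def
    by (rule summable_on_comparison_test[OF has_sum_imp_summable[OF B]]) (use le k_nonneg in auto)
  then show "conv_summable k f g"
    unfolding conv_summable_def
    by (subst summable_on_iff_abs_summable_on_real)
       (simp add: case_prod_unfold abs_mult k_nonneg)
  show "conv_form k (\<lambda>i. \<bar>f i\<bar>) (\<lambda>j. \<bar>g j\<bar>) \<le> M powr \<theta> *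
      (\<alpha> * (lp_norm r f powr r * lp_norm s g powr s)
        + \<beta> * (lp_norm r f powr r * lp_norm q k powr q)
        + \<gamma> * (lp_norm s g powr s * lp_norm q k powr q))"
    by (rule has_sum_mono[OF has_sum_conv_form[OF abs] B]) (use le in auto)
qed

definition "Q = \<alpha> + (\<beta> + \<gamma>) * lp_norm q k powr q"

lemma Q_pos: "Q > 0"
  unfolding Q_def using exponents by (intro add_pos_nonneg) auto

lemma conv_summable: "f \<in> lp_space r \<Longrightarrow> g \<in> lp_space s \<Longrightarrow> conv_summable k f g"
  by (rule conv_bound(1)[where M = "lp_norm r f"]) (use r in \<open>auto intro: abs_le_lp_norm\<close>)

lemma conv_form_le_abs:
  assumes "f \<in> lp_space r" "g \<in> lp_space s"
  shows "conv_form k f g \<le> conv_form k (\<lambda>i. \<bar>f i\<bar>) (\<lambda>j. \<bar>g j\<bar>)"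
  using assms by (intro conv_form_mono conv_summable k_nonneg) (auto simp flip: abs_mult)

text \<open>
  The positive power of \<open>M\<close> excludes vanishing: a pair whose form is not small has a large value.
\<close>
lemma normalized_bound:
  assumes "f \<in> lp_space r" "g \<in> lp_space s" "lp_norm r f = 1" "lp_norm s g = 1"
    and "\<And>i. \<bar>f i\<bar> \<le> M"
  shows "conv_form k f g \<le> M powr \<theta> * Q"
  using conv_form_le_abs[OF assms(1,2)] conv_bound(3)[OF assms(1,2,5)] assms(3,4)
  by (simp add: Q_def algebra_simps)

lemma conv_const_upper_normalized:
  assumes "f \<in> lp_space r" "g \<in> lp_space s" "lp_norm r f = 1" "lp_norm s g = 1"
  shows "conv_form k f g \<le> conv_const k r s"
  unfolding conv_const_def
proof (rule cSup_upper)
  show "bdd_above {conv_form k f g | f g.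
     f \<in> lp_space r \<and> g \<in> lp_space s \<and> lp_norm r f = 1 \<and> lp_norm s g = 1}"
  proof (rule bdd_aboveI)
    fix x assume "x \<in> {conv_form k f g | f g.
      f \<in> lp_space r \<and> g \<in> lp_space s \<and> lp_norm r f = 1 \<and> lp_norm s g = 1}"
    then obtain u v where "x = conv_form k u v"
      and uv: "u \<in> lp_space r" "v \<in> lp_space s" "lp_norm r u = 1" "lp_norm s v = 1"
      by auto
    have "\<bar>u i\<bar> \<le> 1" for i
      using abs_le_lp_norm[OF uv(1), of i] r uv(3) by simp
    from normalized_bound[OF uv this] show "x \<le> Q"
      by (simp add: \<open>x = _\<close>)
  qed
qed (use assms in auto)

lemma conv_const_upper:
  assumes u: "u \<in> lp_space r" and v: "v \<in> lp_space s"
  shows "conv_form k u v \<le> conv_const k r s * lp_norm r u * lp_norm s v"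
proof (cases "lp_norm r u = 0 \<or> lp_norm s v = 0")
  case True
  then have "u = (\<lambda>i. 0) \<or> v = (\<lambda>j. 0)"
    using lp_norm_eq_0 u v r s by fastforce
  then have "conv_form k u v = 0"
    by (auto simp: conv_form_def case_prod_unfold)
  with True show ?thesis by auto
next
  case False
  let ?a = "lp_norm r u" and ?b = "lp_norm s v"
  have pos: "?a > 0" "?b > 0"
    using False lp_norm_nonneg[of r u] lp_norm_nonneg[of s v] by linarith+
  have "conv_form k (\<lambda>i. (1 / ?a) * u i) (\<lambda>j. (1 / ?b) * v j) \<le> conv_const k r s"
    using lp_cmult[OF u, of "1 / ?a"] lp_cmult[OF v, of "1 / ?b"] r s pos
    by (intro conv_const_upper_normalized) simp_all
  also have "conv_form k (\<lambda>i. (1 / ?a) * u i) (\<lambda>j. (1 / ?b) * v j)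
      = (1 / ?a) * (1 / ?b) * conv_form k u v"
    using u v by (intro conv_form_cmult conv_summable)
  finally show ?thesis
    using pos by (simp add: field_simps)
qed

lemma conv_const_pos:
  assumes "a \<noteq> 0" "k a > 0"
  shows "conv_const k r s > 0"
proof -
  let ?\<delta> = "\<lambda>b x. if x = b then 1 else 0 :: real"
  have "((\<lambda>(i, j). ?\<delta> a i * ?\<delta> 0 j * k (i - j)) has_sum k a) UNIV"
    by (rule has_sum_finite_neutralI[of "{(a, 0)}"]) (auto split: if_splits)
  then have "conv_form k (?\<delta> a) (?\<delta> 0) = k a"
    by (rule conv_formI)
  moreover have "conv_form k (?\<delta> a) (?\<delta> 0) \<le> conv_const k r s"
    using r s by (intro conv_const_upper_normalized lp_delta) auto
  ultimately show ?thesis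
    using assms by simp
qed

section \<open>Concentrated maximizing sequences and their limits\<close>

text \<open>
  Since \<open>c powr \<theta> * Q < b\<close>, a normalized pair with form above \<open>b\<close> cannot have all values of
  \<open>\<bar>f\<bar>\<close> at most \<open>c\<close>. A value above \<open>c\<close> is translated to the origin.
\<close>
lemma concentrated_near_maximizer:
  assumes c: "c powr \<theta> * Q < b" "b < conv_const k r s"
  obtains f g where "f \<in> lp_space r" "g \<in> lp_space s" "lp_norm r f = 1" "lp_norm s g = 1"
    "\<And>i. 0 \<le> f i" "\<And>j. 0 \<le> g j" "b < conv_form k f g" "c < f 0"
proof -
  let ?S = "{conv_form k f g | f g.
    f \<in> lp_space r \<and> g \<in> lp_space s \<and> lp_norm r f = 1 \<and> lp_norm s g = 1}"
  have "(\<lambda>x::'a. if x = 0 then 1 else 0) \<in> lp_space p"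
    "lp_norm p (\<lambda>x::'a. if x = 0 then 1 else 0) = 1" if "p > 1" for p
    using lp_delta[of p "0::'a"] that by simp_all
  then have "?S \<noteq> {}"
    using r s by blast
  then obtain u v where uv: "u \<in> lp_space r" "v \<in> lp_space s" "lp_norm r u = 1" "lp_norm s v = 1"
    and "b < conv_form k u v"
    using less_cSupD[OF _ c(2)[unfolded conv_const_def]] by blast
  then have less: "b < conv_form k (\<lambda>i. \<bar>u i\<bar>) (\<lambda>j. \<bar>v j\<bar>)"
    using conv_form_le_abs[OF uv(1,2)] by linarith
  have "\<not> (\<forall>i. \<bar>u i\<bar> \<le> c)"
    using normalized_bound[of "\<lambda>i. \<bar>u i\<bar>" "\<lambda>j. \<bar>v j\<bar>" c] uv less c(1) by fastforce
  then obtain a where a: "c < \<bar>u a\<bar>"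
    by (auto simp: not_le)
  have bij: "bij (\<lambda>i. i + a)"
    by (rule bij_betw_byWitness[where f' = "\<lambda>i. i - a"]) auto
  show thesis
  proof (rule that)
    show "b < conv_form k (\<lambda>i. \<bar>u (i + a)\<bar>) (\<lambda>j. \<bar>v (j + a)\<bar>)"
      using less conv_form_translate[of k "\<lambda>i. \<bar>u i\<bar>" a "\<lambda>j. \<bar>v j\<bar>"] by simp
  qed (use a uv lp_norm_cong_bij[OF bij] in auto)
qed

text \<open>
  The values of a concentrated maximizing sequence are bounded, so by countability a subsequence
  converges at every point. The limits satisfy both equations, where the second one is the first
  for the exchanged pair, as \<open>k\<close> is even. Concentration at the origin makes them nonzero.
\<close>
theorem positive_solution:
  assumes "infinite (UNIV :: 'a set)" "countable (UNIV :: 'a set)"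
    and k_even: "\<And>x. k (- x) = k x" and k_pos: "\<And>x. x \<noteq> 0 \<Longrightarrow> k x > 0"
  obtains f g where "\<And>i. 0 < f i" "\<And>i. 0 < g i"
    "\<And>i. ((\<lambda>j. g j * k (i - j)) has_sum conv_const k r s * f i powr (r - 1)) UNIV"
    "\<And>i. ((\<lambda>j. f j * k (i - j)) has_sum conv_const k r s * g i powr (s - 1)) UNIV"
proof -
  define K where "K = conv_const k r s"
  have other: "\<exists>j. j \<notin> A" if "finite A" for A :: "'a set"
    using assms(1) that ex_new_if_finite by blast
  have K: "K > 0"
    using other[of "{0}"] k_pos conv_const_pos by (auto simp: K_def)
  \<comment> \<open>With this \<open>c\<close>, normalized pairs with values at most \<open>c\<close> have form at most \<open>K / 4\<close>.\<close>
  define c where "c = (K / (4 * Q)) powr (1 / \<theta>)"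
  have c: "c > 0" "c powr \<theta> * Q = K / 4"
    using K Q_pos \<theta> by (simp_all add: c_def powr_powr)
  \<comment> \<open>The offset 2 keeps every threshold at or above \<open>K / 2\<close>.\<close>
  define b where "b n = K * (1 - 1 / (real n + 2))" for n
  have b: "c powr \<theta> * Q < b n" "b n < K" for n
  proof -
    have "1 / (real n + 2) \<le> 1 / 2"
      by (intro divide_left_mono) auto
    then have "K * (1 / 2) \<le> b n"
      unfolding b_def using K by (intro mult_left_mono) auto
    then show "c powr \<theta> * Q < b n"
      using c K by linarith
    show "b n < K"
      using K by (simp add: b_def)
  qed
  have "\<exists>f g. f \<in> lp_space r \<and> g \<in> lp_space s \<and> lp_norm r f = 1 \<and> lp_norm s g = 1 \<and>
    (\<forall>i. 0 \<le> f i) \<and> (\<forall>j. 0 \<le> g j) \<and> b n < conv_form k f g \<and> c < f 0" for n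
    using concentrated_near_maximizer[OF b[of n, unfolded K_def]] by metis
  then obtain F G where FG: "\<And>n. F n \<in> lp_space r" "\<And>n. G n \<in> lp_space s"
      "\<And>n. lp_norm r (F n) = 1" "\<And>n. lp_norm s (G n) = 1"
      "\<And>n i. 0 \<le> F n i" "\<And>n i. 0 \<le> G n i" "\<And>n. b n < conv_form k (F n) (G n)" "\<And>n. c < F n 0"
    by metis
  have bounded: "norm (F n x, G n x) \<le> 2" for n x
  proof -
    have "norm (F n x) \<le> 1" "norm (G n x) \<le> 1"
      using abs_le_lp_norm[OF FG(1)[of n], of x] abs_le_lp_norm[OF FG(2)[of n], of x] r s FG(3,4) by auto
    then show ?thesis
      using norm_Pair_le[of "F n x" "G n x"] by linarith
  qed
  obtain \<phi> where \<phi>: "strict_mono \<phi>" "\<And>x. \<exists>l. (\<lambda>n. (F (\<phi> n) x, G (\<phi> n) x)) \<longlonglongrightarrow> l"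
    using function_convergent_subsequence[of UNIV "\<lambda>n x. (F n x, G n x)" 2] assms(2) bounded by auto
  then obtain l where l: "\<And>x. (\<lambda>n. (F (\<phi> n) x, G (\<phi> n) x)) \<longlonglongrightarrow> l x"
    by metis
  define f where "f x = fst (l x)" for x
  define g where "g x = snd (l x)" for x
  have f: "(\<lambda>n. F (\<phi> n) x) \<longlonglongrightarrow> f x" and g: "(\<lambda>n. G (\<phi> n) x) \<longlonglongrightarrow> g x" for x
    using tendsto_fst[OF l] tendsto_snd[OF l] by (simp_all add: f_def g_def)
  have "(\<lambda>n. conv_form k (F n) (G n)) \<longlonglongrightarrow> K"
  proof (rule tendsto_sandwich)
    show "\<forall>\<^sub>F n in sequentially. b n \<le> conv_form k (F n) (G n)"
      by (intro always_eventually allI less_imp_le FG(7))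
    show "\<forall>\<^sub>F n in sequentially. conv_form k (F n) (G n) \<le> K"
      using conv_const_upper_normalized FG by (auto simp: K_def)
    have "(\<lambda>n. 1 / (real n + 2)) \<longlonglongrightarrow> 0"
      using LIMSEQ_ignore_initial_segment[OF lim_1_over_n, of 2] by (simp add: add.commute)
    from tendsto_mult[OF tendsto_const tendsto_diff[OF tendsto_const this]]
    show "b \<longlonglongrightarrow> K"
      unfolding b_def[abs_def] by (metis diff_zero mult_1_right)
  qed simp
  from LIMSEQ_subseq_LIMSEQ[OF this \<phi>(1)]
  have maximizing: "(\<lambda>n. conv_form k (F (\<phi> n)) (G (\<phi> n))) \<longlonglongrightarrow> K"
    by (simp add: o_def)
  have eq_f: "((\<lambda>j. g j * k (i - j)) has_sum K * f i powr (r - 1)) UNIV" for i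
    by (rule euler_lagrange_limit[OF r s K k_nonneg k_lp_conjugate(2) conv_summable
          conv_const_upper[folded K_def] FG(1,3,5) FG(2,4,6) maximizing f g])
  have eq_g: "((\<lambda>j. f j * k (i - j)) has_sum K * g i powr (s - 1)) UNIV" for i
  proof (rule euler_lagrange_limit[OF s r K k_nonneg k_lp_conjugate(1) _ _ FG(2,4,6) FG(1,3,5) _ g f])
    show "conv_summable k u v" if "u \<in> lp_space s" "v \<in> lp_space r" for u v
      using conv_summable[OF that(2,1)] conv_form_commute(1)[of k u v] k_even by simp
    show "conv_form k u v \<le> K * lp_norm s u * lp_norm r v" if "u \<in> lp_space s" "v \<in> lp_space r" for u v
      using conv_const_upper[OF that(2,1)] conv_form_commute(2)[of k u v] k_even
      by (simp add: K_def mult_ac)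
    show "(\<lambda>n. conv_form k (G (\<phi> n)) (F (\<phi> n))) \<longlonglongrightarrow> K"
      using maximizing conv_form_commute(2)[of k "F _" "G _"] k_even by simp
  qed
  have nonneg: "0 \<le> f x" "0 \<le> g x" for x
    using LIMSEQ_le_const[OF f] LIMSEQ_le_const[OF g] FG(5,6) by blast+
  \<comment> \<open>If one of the functions is positive at \<open>a\<close>, the other one is positive at every other point.\<close>
  have spread: "v i > 0"
    if "((\<lambda>j. u j * k (i - j)) has_sum K * v i powr p) UNIV" "\<And>j. 0 \<le> u j" "0 \<le> v i" "u a > 0" "a \<noteq> i"
    for u v :: "'a \<Rightarrow> real" and a i p
  proof -
    have "0 < u a * k (i - a)"
      using that k_pos by simp
    also have "\<dots> \<le> K * v i powr p"
      using finite_sum_le_has_sum[OF that(1), of "{a}"] that(2) k_nonneg by simp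
    finally show ?thesis
      using that(3) by (cases "v i = 0") auto
  qed
  have "c \<le> f 0"
    using f by (rule LIMSEQ_le_const) (use FG(8) in \<open>auto intro: less_imp_le\<close>)
  then have f0: "f 0 > 0"
    using c by linarith
  have g_off: "g i > 0" if "i \<noteq> 0" for i
    by (rule spread[where a = 0, OF eq_g]) (use nonneg f0 that in auto)
  have f_pos: "f i > 0" for i
  proof -
    obtain a where "a \<notin> {0, i}"
      using other[of "{0, i}"] by auto
    show ?thesis
      by (rule spread[where a = a, OF eq_f]) (use \<open>a \<notin> {0, i}\<close> g_off nonneg in auto)
  qed
  have g_pos: "g i > 0" for i
  proof -
    obtain a where "a \<notin> {i}"
      using other[of "{i}"] by auto
    show ?thesis
      by (rule spread[where a = a, OF eq_g]) (use \<open>a \<notin> {i}\<close> f_pos nonneg in auto)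
  qed
  show thesis
    by (rule that[OF f_pos g_pos eq_f[unfolded K_def] eq_g[unfolded K_def]])
qed

end

section \<open>The system on the integer lattice\<close>

theorem corollary6:
  fixes r s l K :: real
  assumes "r > 1" and "s > 1"
    and "0 < l" and "l < real CARD('n::finite)"
    and "1 / r + 1 / s + l / real CARD('n) > 2"
    and "K = hls_const TYPE('n) l r s"
  shows "\<exists>f g :: int ^ 'n \<Rightarrow> real.
           (\<forall>i. f i > 0) \<and> (\<forall>i. g i > 0) \<and>
           (\<forall>i. ((\<lambda>j. g j / lattice_norm (i - j) powr l)
                   has_sum K * f i powr (r - 1)) {j. j \<noteq> i}) \<and>
           (\<forall>i. ((\<lambda>j. f j / lattice_norm (i - j) powr l)
                   has_sum K * g i powr (s - 1)) {j. j \<noteq> i})"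
proof -
  define N where "N = real CARD('n)"
  have N: "N > 0" "l / N < 1"
    using assms by (simp_all add: N_def)
  define k where "k x = lattice_norm x powr (- l)" for x :: "int ^ 'n"
  have k_eq: "a * k (i - j) = a / lattice_norm (i - j) powr l" for a i j
    by (simp add: k_def powr_minus divide_inverse)
  \<comment> \<open>Any \<open>\<theta> < 1\<close> below the excess of the exponents works, since it changes \<open>1 / r\<close> by \<open>\<theta> / r < \<theta>\<close>.\<close>
  define \<theta> where "\<theta> = min (1 / 2) ((1 / r + 1 / s + l / N - 2) / 2)"
  have \<theta>: "0 < \<theta>" "\<theta> < 1" "\<theta> < 1 / r + 1 / s + l / N - 2"
  proof -
    define d where "d = 1 / r + 1 / s + l / N - 2"
    have "d > 0" "\<theta> = min (1 / 2) (d / 2)"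
      using assms(5) by (simp_all add: \<theta>_def d_def N_def)
    then show "0 < \<theta>" "\<theta> < 1" "\<theta> < 1 / r + 1 / s + l / N - 2"
      unfolding d_def[symmetric] by auto
  qed
  have "\<theta> / r < \<theta>"
    using \<theta> assms(1) by (simp add: field_simps)
  then have gap: "2 - l / N < (1 - \<theta>) / r + 1 / s"
    using \<theta> by (simp add: diff_divide_distrib)
  then have "(1 - \<theta>) / r + 1 / s > 1"
    using N by linarith
  let ?q = "1 / (2 - (1 - \<theta>) / r - 1 / s)"
  have "(1 - \<theta>) / r < 1" "1 / s < 1"
    using \<theta> assms(1,2) by simp_all
  then have "l * ?q > N"
    using gap N by (simp add: field_simps)
  then have "(\<lambda>x::int ^ 'n. lattice_norm x powr (- (l * ?q))) summable_on UNIV"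
    by (intro lattice_norm_powr_summable) (simp add: N_def)
  then have k_lp: "k \<in> lp_space ?q"
    by (simp add: lp_space_def k_def powr_powr)
  interpret subcritical_kernel k r s \<theta>
    by standard (use assms(1,2) \<theta> \<open>(1 - \<theta>) / r + 1 / s > 1\<close> k_lp in \<open>auto simp: k_def\<close>)
  \<comment> \<open>Constant vectors embed the integers.\<close>
  have infinite: "infinite (UNIV :: (int ^ 'n) set)"
  proof
    assume "finite (UNIV :: (int ^ 'n) set)"
    then have "finite (range (\<lambda>m::int. (\<chi> k. m) :: int ^ 'n))"
      by (rule finite_subset[rotated]) simp
    then show False
      by (subst (asm) finite_image_iff) (auto simp: inj_on_def vec_eq_iff)
  qed
  have pos: "k x > 0" if "x \<noteq> 0" for x
    using lattice_norm_ge_1[OF that] by (simp add: k_def)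
  \<comment> \<open>On the diagonal \<open>k 0 = 0 powr (- l) = 0\<close>, so all pairs may be included.\<close>
  have form: "hls_form l f g = conv_form k f g" for f g
    unfolding hls_form_def conv_form_def k_eq
    by (rule infsum_cong_neutral) auto
  have K: "K = conv_const k r s"
    by (simp add: assms(6) hls_const_def conv_const_def form)
  have restrict: "((\<lambda>j. u j * k (i - j)) has_sum S) UNIV \<longleftrightarrow>
      ((\<lambda>j. u j / lattice_norm (i - j) powr l) has_sum S) {j. j \<noteq> i}" for u S i
    unfolding k_eq by (rule has_sum_cong_neutral) auto
  obtain f g where "\<And>i. 0 < f i" "\<And>i. 0 < g i"
    "\<And>i. ((\<lambda>j. g j * k (i - j)) has_sum K * f i powr (r - 1)) UNIV"
    "\<And>i. ((\<lambda>j. f j * k (i - j)) has_sum K * g i powr (s - 1)) UNIV"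
    unfolding K
    by (rule positive_solution[OF infinite _ _ pos]) (auto simp: k_def lattice_norm_minus)
  then show ?thesis
    unfolding restrict by blast
qed

end
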